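(* Let $F$ be a field with $\operatorname{Char}(F)\neq 2$ and let $R$ be a simple associative unital $F$-algebra with $\dim_{Z(R)}R>4$. Let $*$ be an involution on $R$ of the first kind with set of symmetric elements $S$ and set of skew-symmetric elements $K$, and assume $S\subsetneq R$. Assume $S$ is not a commutative set. Then: (1) $K^6=R$, and more specifically $(K\circ K)^3=R$. (2) If, in addition, there exist $x,y\in S$ such that $xy-yx\neq 0$ and for every $s\in S$, $xsy\in S^2$, then $K^4=R$, and more specifically $(K\circ K)^2=R$. Likewise, if, in addition, there exist $x,y\in S$ such that $xy+yx\neq 0$ and for every $k\in K$, $xky\in S^2$, then $K^4=R$, and more specifically $(K\circ K)^2=R$.
   Context: $S=\{r\in R: r^*=r\}$ and $K=\{r\in R: r^*=-r\}$. The involution $*$ is of the first kind if $Z(R)\subseteq S$, where $Z(R)$ is the center of $R$ (a field, since $R$ is simple; $\dim_{Z(R)}R$ may be infinite). A subset $A\subseteq R$ is a commutative set if $xy=yx$ for all $x,y\in A$. For subsets $A,B\subseteq R$, $AB$ denotes the $F$-subspace of $R$ generated by all products $ab$ with $a\in A$, $b\in B$, and $A^n$ is the $F$-subspace generated by all products of $n$ elements of $A$. $A\circ B$ denotes the $F$-subspace of $R$ generated by all $ab+ba$ with $a\in A$, $b\in B$. *)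

theory Defs
  imports Complex_Main
begin

locale unital_algebra = vector_space scale
  for scale :: "'f::field \<Rightarrow> 'r::ring_1 \<Rightarrow> 'r" +
  assumes scale_mult_left: "scale a x * y = scale a (x * y)"
    and scale_mult_right: "x * scale a y = scale a (x * y)"
begin

definition subspace_power :: "'r set \<Rightarrow> nat \<Rightarrow> 'r set" where
  "subspace_power A n = span {prod_list xs | xs. set xs \<subseteq> A \<and> length xs = n}"

definition jordan_product :: "'r set \<Rightarrow> 'r set \<Rightarrow> 'r set" where
  "jordan_product A B = span {a * b + b * a | a b. a \<in> A \<and> b \<in> B}"

end

text \<open>Closure under negation follows from absorption of \<open>- 1\<close>. Since the ring is unital,
  ring ideals are the same as algebra ideals.\<close>

definition two_sided_ideal :: "'r::ring_1 set \<Rightarrow> bool" where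
  "two_sided_ideal I \<longleftrightarrow>
     0 \<in> I \<and> (\<forall>x\<in>I. \<forall>y\<in>I. x + y \<in> I) \<and> (\<forall>r. \<forall>x\<in>I. r * x \<in> I \<and> x * r \<in> I)"

text \<open>The class \<open>ring_1\<close> already includes \<open>0 \<noteq> 1\<close>.\<close>

definition simple_ring :: "'r::ring_1 itself \<Rightarrow> bool" where
  "simple_ring _ \<longleftrightarrow> (\<forall>I :: 'r set. two_sided_ideal I \<longrightarrow> I = {0} \<or> I = UNIV)"

definition ring_center :: "'r::ring_1 set" where
  "ring_center = {z. \<forall>x. z * x = x * z}"

text \<open>Linear algebra of a ring over its center. The center is a subset of the ring and not a
  type, so the library's \<open>vector_space\<close> locale does not apply to it; the following are its notions
  of independence and span with the coefficients restricted to the center.\<close>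

definition center_independent :: "'r::ring_1 set \<Rightarrow> bool" where
  "center_independent B \<longleftrightarrow>
     (\<forall>T c. finite T \<and> T \<subseteq> B \<and> (\<forall>b\<in>T. c b \<in> ring_center) \<and> (\<Sum>b\<in>T. c b * b) = 0
        \<longrightarrow> (\<forall>b\<in>T. c b = 0))"

definition center_span :: "'r::ring_1 set \<Rightarrow> 'r set" where
  "center_span B =
     {\<Sum>b\<in>T. c b * b | T c. finite T \<and> T \<subseteq> B \<and> (\<forall>b\<in>T. c b \<in> ring_center)}"

definition center_basis :: "'r::ring_1 set \<Rightarrow> bool" where
  "center_basis B \<longleftrightarrow> center_independent B \<and> center_span B = UNIV"

text \<open>The dimension over the center is the cardinality of any basis (for a simple ring the center
  is a field, so bases exist and are equipotent). It may be infinite, where \<open>card\<close> would be 0.\<close>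

definition center_dim_greater :: "'r::ring_1 itself \<Rightarrow> nat \<Rightarrow> bool" where
  "center_dim_greater _ n \<longleftrightarrow> (\<exists>B :: 'r set. center_basis B \<and> (infinite B \<or> n < card B))"

text \<open>Linearity over a base field is not part of the definition. For an involution of the first
  kind on a unital algebra it is automatic, as scalar multiples of 1 are central.\<close>

definition involution :: "('r::ring_1 \<Rightarrow> 'r) \<Rightarrow> bool" where
  "involution star \<longleftrightarrow>
     (\<forall>x y. star (x + y) = star x + star y) \<and>
     (\<forall>x y. star (x * y) = star y * star x) \<and>
     (\<forall>x. star (star x) = x)"

definition symmetric_elements :: "('r::ring_1 \<Rightarrow> 'r) \<Rightarrow> 'r set" where
  "symmetric_elements star = {r. star r = r}"

definition skew_elements :: "('r::ring_1 \<Rightarrow> 'r) \<Rightarrow> 'r set" where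
  "skew_elements star = {r. star r = - r}"

definition first_kind :: "('r::ring_1 \<Rightarrow> 'r) \<Rightarrow> bool" where
  "first_kind star \<longleftrightarrow> ring_center \<subseteq> symmetric_elements star"

definition commutative_set :: "'r::ring_1 set \<Rightarrow> bool" where
  "commutative_set A \<longleftrightarrow> (\<forall>x\<in>A. \<forall>y\<in>A. x * y = y * x)"

end

theory Submission
  imports Defs
begin

text \<open>Everything rests on Herstein's dichotomy for Lie ideals: over a simple ring without 2-torsion,
  a Lie ideal is central or contains all commutators
  (\<open>lie_ideal_central_or_contains_commutators\<close>). Both \<open>K\<^sup>2\<close> and \<open>S\<^sup>2\<close> are Lie ideals
  (\<open>lie_ideal_square\<close>). Write \<open>[x, y] = x y - y x\<close> and \<open>x \<circ> y = x y + y x\<close>.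

  The square \<open>K\<^sup>2\<close> is not central: otherwise \<open>K\<close> is a line \<open>Z k\<close> over the center \<open>Z\<close>, and \<open>R\<close>
  is the span of \<open>1, k, s, s k\<close> for a symmetric \<open>s\<close> anticommuting with \<open>k\<close>, contrary to the
  hypothesis on the dimension (\<open>skew_product_not_central\<close>). So \<open>K\<^sup>2\<close> contains all commutators,
  whence \<open>[K, S] \<subseteq> K \<circ> K\<close>. With this, \<open>K \<circ> K + K\<close> is a nonzero two-sided ideal; it is
  therefore \<open>R\<close>, and comparing symmetric parts gives \<open>K \<circ> K = S\<close>
  (\<open>jordan_product_skew_eq_symmetric\<close>).

  It remains to study powers of \<open>S\<close>. As \<open>S\<close> is not commutative, \<open>S\<^sup>2\<close> contains all
  commutators. A subspace containing all commutators is everything once it contains a nonzero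
  right ideal \<open>c R\<close> (\<open>eq_UNIV_if_right_ideal_and_commutators\<close>). For \<open>S\<^sup>3\<close> one takes
  \<open>c = [s, t]\<close>, since \<open>[s, t] r = [s, t r] - t [s, r]\<close>. Under the additional hypotheses
  already \<open>S\<^sup>2\<close> works: modulo commutators, factors may be permuted cyclically, so
  \<open>x r y\<close> and its image under the involution show that \<open>c = [x, y]\<close>, respectively
  \<open>c = x \<circ> y\<close>, multiplies one of the two parts of \<open>R = S + K\<close> into \<open>S\<^sup>2\<close>, and
  a parity argument handles the other part.\<close>

section \<open>Simple rings and their centers\<close>

lemma ring_center_commute: "z \<in> ring_center \<Longrightarrow> x * z = z * x"
  by (simp add: ring_center_def)

lemma ring_center_zero [simp]: "0 \<in> ring_center"
  and ring_center_one [simp]: "1 \<in> ring_center"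
  by (simp_all add: ring_center_def)

lemma ring_center_add: "z \<in> ring_center \<Longrightarrow> w \<in> ring_center \<Longrightarrow> z + w \<in> ring_center"
  by (simp add: ring_center_def algebra_simps)

lemma ring_center_minus: "z \<in> ring_center \<Longrightarrow> - z \<in> ring_center"
  by (simp add: ring_center_def)

lemma ring_center_diff: "z \<in> ring_center \<Longrightarrow> w \<in> ring_center \<Longrightarrow> z - w \<in> ring_center"
  by (simp add: ring_center_def algebra_simps)

lemma ring_center_mult:
  assumes "z \<in> ring_center" "w \<in> ring_center"
  shows "z * w \<in> ring_center"
proof -
  have "z * w * x = x * (z * w)" for x
  proof -
    have "z * w * x = z * x * w"
      using ring_center_commute[OF assms(2), of x] by (simp add: mult.assoc)
    also have "\<dots> = x * (z * w)"
      using ring_center_commute[OF assms(1), of x] by (simp add: mult.assoc[symmetric])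
    finally show ?thesis .
  qed
  then show ?thesis by (simp add: ring_center_def)
qed

lemma ring_center_sum: "(\<And>i. i \<in> I \<Longrightarrow> f i \<in> ring_center) \<Longrightarrow> sum f I \<in> ring_center"
  by (induction I rule: infinite_finite_induct) (auto intro: ring_center_add)

text \<open>The elements \<open>x\<close> with \<open>R x R \<subseteq> U\<close> form a two-sided ideal, so that \<open>U\<close> itself
  need only be additively closed.\<close>

lemma simple_ring_eq_UNIV_if_absorbs:
  fixes U :: "'r::ring_1 set"
  assumes simple: "simple_ring TYPE('r)"
    and zero: "0 \<in> U" and add: "\<And>x y. x \<in> U \<Longrightarrow> y \<in> U \<Longrightarrow> x + y \<in> U"
    and "c \<noteq> 0" and absorbs: "\<And>r s. r * c * s \<in> U"
  shows "U = UNIV"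
proof -
  let ?I = "{x. \<forall>r s. r * x * s \<in> U}"
  have "two_sided_ideal ?I"
    unfolding two_sided_ideal_def
  proof (intro conjI ballI allI)
    fix x y assume "x \<in> ?I" "y \<in> ?I"
    then show "x + y \<in> ?I" by (auto simp: algebra_simps intro: add)
  next
    fix r x assume "x \<in> ?I"
    then have x: "a * x * b \<in> U" for a b by blast
    show "r * x \<in> ?I" using x[of "_ * r"] by (simp add: mult.assoc)
    show "x * r \<in> ?I" using x[of _ "r * _"] by (simp add: mult.assoc)
  qed (simp add: zero)
  moreover have "c \<in> ?I" using absorbs by blast
  ultimately have "?I = UNIV" using simple \<open>c \<noteq> 0\<close> unfolding simple_ring_def by blast
  then have "1 * x * 1 \<in> U" for x by blast
  then show ?thesis by auto
qed

text \<open>The elements \<open>x\<close> with \<open>x R b = 0\<close> form a two-sided ideal, which contains 1 only if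
  \<open>b = 0\<close>.\<close>

lemma simple_ring_prime:
  fixes a b :: "'r::ring_1"
  assumes simple: "simple_ring TYPE('r)" and zero: "\<And>r. a * r * b = 0"
  shows "a = 0 \<or> b = 0"
proof -
  let ?L = "{x. \<forall>r. x * r * b = 0}"
  have "two_sided_ideal ?L"
    unfolding two_sided_ideal_def
  proof (intro conjI ballI allI)
    fix x y assume "x \<in> ?L" "y \<in> ?L"
    then show "x + y \<in> ?L" by (auto simp: algebra_simps)
  next
    fix r x assume "x \<in> ?L"
    then have x: "x * a * b = 0" for a by blast
    show "r * x \<in> ?L" using x by (simp add: mult.assoc)
    show "x * r \<in> ?L" using x[of "r * _"] by (simp add: mult.assoc)
  qed simp
  then consider "?L = {0}" | "?L = UNIV" using simple unfolding simple_ring_def by blast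
  then show ?thesis
  proof cases
    case 1
    moreover have "a \<in> ?L" using zero by blast
    ultimately show ?thesis by blast
  next
    case 2
    then have "1 * 1 * b = 0" by blast
    then show ?thesis by simp
  qed
qed

lemma simple_ring_center_no_zero_divisors:
  fixes z x :: "'r::ring_1"
  assumes "simple_ring TYPE('r)" "z \<in> ring_center" "z * x = 0"
  shows "z = 0 \<or> x = 0"
proof (rule simple_ring_prime[OF assms(1)])
  fix r
  have "z * r * x = r * (z * x)"
    using ring_center_commute[OF assms(2), of r] by (simp add: mult.assoc[symmetric])
  then show "z * r * x = 0" using assms(3) by simp
qed

lemma simple_ring_center_inverse:
  fixes z :: "'r::ring_1"
  assumes simple: "simple_ring TYPE('r)" and z: "z \<in> ring_center" "z \<noteq> 0"
  obtains w where "w \<in> ring_center" "w * z = 1"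
proof -
  have "range ((*) z) = UNIV"
  proof (rule simple_ring_eq_UNIV_if_absorbs[OF simple])
    show "0 \<in> range ((*) z)" by (rule range_eqI[of _ _ 0]) simp
    show "x + y \<in> range ((*) z)" if "x \<in> range ((*) z)" "y \<in> range ((*) z)" for x y
      using that by (auto simp: image_iff) (metis distrib_left)
    show "r * z * s \<in> range ((*) z)" for r s
      using ring_center_commute[OF z(1), of r] by (auto simp: mult.assoc)
  qed (fact z(2))
  then obtain w where w: "z * w = 1" by (metis surjE)
  have zw: "w * z = 1" using w ring_center_commute[OF z(1), of w] by simp
  have "w * x = x * w" for x
  proof -
    have "w * x = w * (x * z) * w" using w by (simp add: mult.assoc)
    also have "\<dots> = w * (z * x) * w" using ring_center_commute[OF z(1), of x] by simp
    also have "\<dots> = x * w" using zw by (simp add: mult.assoc[symmetric])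
    finally show ?thesis .
  qed
  then have "w \<in> ring_center" by (simp add: ring_center_def)
  then show thesis using zw that by blast
qed

text \<open>Gaussian elimination. Cross-multiplying the equations with a pivot, instead of dividing by
  it, uses only that the center has no zero divisors.\<close>

lemma central_homogeneous_system_nontrivial_solution:
  fixes c :: "'i \<Rightarrow> 'j \<Rightarrow> 'r::ring_1"
  assumes simple: "simple_ring TYPE('r)"
    and "finite A" "finite T" "card A < card T" "\<And>t a. t \<in> T \<Longrightarrow> a \<in> A \<Longrightarrow> c t a \<in> ring_center"
  shows "\<exists>x. (\<forall>t\<in>T. x t \<in> ring_center) \<and> (\<exists>t\<in>T. x t \<noteq> 0) \<and> (\<forall>a\<in>A. (\<Sum>t\<in>T. x t * c t a) = 0)"
  using assms(2-)
proof (induction A arbitrary: T c rule: finite_induct)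
  case empty
  then have "T \<noteq> {}" by auto
  then show ?case by (intro exI[of _ "\<lambda>_. 1"]) auto
next
  case (insert a0 A)
  show ?case
  proof (cases "\<forall>t\<in>T. c t a0 = 0")
    case True
    have "card A < card T" using insert by simp
    then obtain x where "\<forall>t\<in>T. x t \<in> ring_center" "\<exists>t\<in>T. x t \<noteq> 0"
        "\<forall>a\<in>A. (\<Sum>t\<in>T. x t * c t a) = 0"
      using insert.IH[of T c] insert.prems by blast
    with True show ?thesis by (intro exI[of _ x]) auto
  next
    case False
    then obtain t0 where t0: "t0 \<in> T" "c t0 a0 \<noteq> 0" by blast
    define p where "p = c t0 a0"
    have p: "p \<in> ring_center" using t0 insert.prems by (simp add: p_def)
    let ?T = "T - {t0}"
    let ?c = "\<lambda>t a. p * c t a - c t a0 * c t0 a"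
    have "card A < card ?T" using insert t0 by simp
    moreover have "?c t a \<in> ring_center" if "t \<in> ?T" "a \<in> A" for t a
      using that insert.prems t0 p by (auto intro!: ring_center_diff ring_center_mult)
    ultimately obtain x where x: "\<forall>t\<in>?T. x t \<in> ring_center" "\<exists>t\<in>?T. x t \<noteq> 0"
        "\<forall>a\<in>A. (\<Sum>t\<in>?T. x t * ?c t a) = 0"
      using insert.IH[of ?T ?c] insert.prems(1) by blast
    (* Solve the pivot equation for the unknown at t0. *)
    define y where "y = (\<lambda>t. if t = t0 then - (\<Sum>u\<in>?T. x u * c u a0) else x t * p)"
    have split: "(\<Sum>t\<in>T. y t * c t a) = (\<Sum>t\<in>?T. x t * ?c t a)" for a
    proof -
      have "(\<Sum>t\<in>T. y t * c t a) = y t0 * c t0 a + (\<Sum>t\<in>?T. y t * c t a)"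
        using insert.prems(1) t0(1) by (simp add: sum.remove)
      also have "(\<Sum>t\<in>?T. y t * c t a) = (\<Sum>t\<in>?T. x t * p * c t a)"
        by (intro sum.cong) (auto simp: y_def)
      finally show ?thesis
        by (simp add: y_def sum_distrib_right sum_subtractf algebra_simps)
    qed
    have "(\<Sum>t\<in>?T. x t * ?c t a0) = 0"
    proof (intro sum.neutral ballI)
      fix t assume "t \<in> ?T"
      have "p * c t a0 = c t a0 * p" using p ring_center_commute by metis
      then show "x t * ?c t a0 = 0" by (simp add: p_def)
    qed
    then have "\<forall>a\<in>insert a0 A. (\<Sum>t\<in>T. y t * c t a) = 0" using x(3) split by simp
    moreover have "\<forall>t\<in>T. y t \<in> ring_center"
      using x(1) p insert.prems
      by (auto simp: y_def intro!: ring_center_mult ring_center_minus ring_center_sum)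
    moreover have "\<exists>t\<in>T. y t \<noteq> 0"
    proof -
      obtain t where t: "t \<in> ?T" "x t \<noteq> 0" using x(2) by blast
      then have "x t * p \<noteq> 0"
        using simple_ring_center_no_zero_divisors[OF simple, of "x t" p] x(1) t0(2)
        by (auto simp: p_def)
      then show ?thesis using t by (auto simp: y_def)
    qed
    ultimately show ?thesis by blast
  qed
qed

text \<open>The family \<open>e\<close> is indexed, so that coincidences among its members do no harm.\<close>

lemma not_center_dim_greater_if_spanned:
  fixes e :: "nat \<Rightarrow> 'r::ring_1"
  assumes simple: "simple_ring TYPE('r)"
    and spanned: "\<And>x. \<exists>c. (\<forall>i<n. c i \<in> ring_center) \<and> x = (\<Sum>i<n. c i * e i)"
  shows "\<not> center_dim_greater TYPE('r) n"
proof
  assume "center_dim_greater TYPE('r) n"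
  then obtain B :: "'r set" where B: "center_independent B" "infinite B \<or> n < card B"
    unfolding center_dim_greater_def center_basis_def by blast
  have "\<exists>T. finite T \<and> T \<subseteq> B \<and> card T = Suc n"
  proof (cases "infinite B")
    case True
    then show ?thesis using infinite_arbitrarily_large[of B "Suc n"] by blast
  next
    case False
    then have "Suc n \<le> card B" using B(2) by simp
    then show ?thesis by (rule obtain_subset_with_card_n) blast
  qed
  then obtain T where T: "finite T" "T \<subseteq> B" "card T = Suc n" by blast
  have "\<exists>c. \<forall>x. (\<forall>i<n. c x i \<in> ring_center) \<and> x = (\<Sum>i<n. c x i * e i)"
    by (intro choice allI spanned)
  then obtain c where c: "\<And>x i. i < n \<Longrightarrow> c x i \<in> ring_center" "\<And>x. x = (\<Sum>i<n. c x i * e i)"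
    by blast
  obtain y where y: "\<forall>t\<in>T. y t \<in> ring_center" "\<exists>t\<in>T. y t \<noteq> 0"
      "\<forall>i\<in>{..<n}. (\<Sum>t\<in>T. y t * c t i) = 0"
    using central_homogeneous_system_nontrivial_solution[OF simple, of "{..<n}" T c] T c(1) by auto
  have "(\<Sum>t\<in>T. y t * t) = (\<Sum>t\<in>T. \<Sum>i<n. y t * c t i * e i)"
  proof (rule sum.cong[OF refl])
    fix t assume "t \<in> T"
    have "y t * t = y t * (\<Sum>i<n. c t i * e i)" using c(2)[of t] by simp
    then show "y t * t = (\<Sum>i<n. y t * c t i * e i)" by (simp add: sum_distrib_left mult.assoc)
  qed
  also have "\<dots> = (\<Sum>i<n. (\<Sum>t\<in>T. y t * c t i) * e i)"
    by (subst sum.swap) (simp add: sum_distrib_right)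
  also have "\<dots> = 0" using y(3) by simp
  finally have "\<forall>t\<in>T. y t = 0"
    using B(1) T y(1) unfolding center_independent_def by blast
  then show False using y(2) by blast
qed

section \<open>Lie ideals of simple rings\<close>

definition lie_ideal :: "'r::ring_1 set \<Rightarrow> bool" where
  "lie_ideal U \<longleftrightarrow>
     0 \<in> U \<and> (\<forall>x\<in>U. \<forall>y\<in>U. x - y \<in> U) \<and> (\<forall>u\<in>U. \<forall>r. u * r - r * u \<in> U)"

text \<open>The set \<open>V = {x. [x, R] \<subseteq> U}\<close> is again a Lie ideal,
  contains \<open>U\<close>, and is moreover a subring. If \<open>x, y \<in> V\<close> do not commute, then
  \<open>[x, y] r = [x, y r] - y [x, r]\<close> shows that \<open>V\<close> contains the two-sided ideal generated by
  \<open>[x, y]\<close>, so \<open>V = R\<close>. If \<open>V\<close> is commutative, then for \<open>a \<in> U\<close> the inner derivation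
  \<open>d = [a, -]\<close> has square zero, which in a prime ring without 2-torsion forces \<open>d = 0\<close>.\<close>

lemma lie_ideal_central_or_contains_commutators:
  fixes U :: "'r::ring_1 set"
  assumes simple: "simple_ring TYPE('r)"
    and torsion: "\<And>x::'r. x + x = 0 \<Longrightarrow> x = 0"
    and U: "lie_ideal U"
  shows "U \<subseteq> ring_center \<or> (\<forall>x y. x * y - y * x \<in> U)"
proof -
  have U0: "0 \<in> U" and Udiff: "\<And>x y. x \<in> U \<Longrightarrow> y \<in> U \<Longrightarrow> x - y \<in> U"
    and Ulie: "\<And>u r. u \<in> U \<Longrightarrow> u * r - r * u \<in> U"
    using U unfolding lie_ideal_def by blast+
  have Uadd: "x + y \<in> U" if "x \<in> U" "y \<in> U" for x y
    using Udiff[OF that(1) Udiff[OF U0 that(2)]] by simp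
  define V where "V = {x. \<forall>r. x * r - r * x \<in> U}"
  have VD: "x * r - r * x \<in> U" if "x \<in> V" for x r using that by (simp add: V_def)
  have UV: "U \<subseteq> V" using Ulie by (auto simp: V_def)
  have V0: "0 \<in> V" using UV U0 by blast
  have Vadd: "x + y \<in> V" if "x \<in> V" "y \<in> V" for x y
  proof -
    have "(x + y) * r - r * (x + y) = (x * r - r * x) + (y * r - r * y)" for r
      by (simp add: algebra_simps)
    then have "(x + y) * r - r * (x + y) \<in> U" for r using Uadd[OF VD VD] that by simp
    then show ?thesis by (simp add: V_def)
  qed
  have Vdiff: "x - y \<in> V" if "x \<in> V" "y \<in> V" for x y
  proof -
    have "(x - y) * r - r * (x - y) = (x * r - r * x) - (y * r - r * y)" for r
      by (simp add: algebra_simps)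
    then have "(x - y) * r - r * (x - y) \<in> U" for r using Udiff[OF VD VD] that by simp
    then show ?thesis by (simp add: V_def)
  qed
  have Vmult: "x * y \<in> V" if "x \<in> V" "y \<in> V" for x y
  proof -
    have "x * y * r - r * (x * y) = (x * (y * r) - (y * r) * x) + (y * (r * x) - (r * x) * y)" for r
      by (simp add: algebra_simps)
    then have "x * y * r - r * (x * y) \<in> U" for r using Uadd[OF VD VD] that by simp
    then show ?thesis by (simp add: V_def)
  qed
  have Vlie: "x * r - r * x \<in> V" if "x \<in> V" for x r using that VD UV by blast
  show ?thesis
  proof (cases "\<exists>x\<in>V. \<exists>y\<in>V. x * y - y * x \<noteq> 0")
    case True
    then obtain x y where xy: "x \<in> V" "y \<in> V" and nz: "x * y - y * x \<noteq> 0" by blast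
    let ?c = "x * y - y * x"
    have right: "?c * r \<in> V" for r
    proof -
      have "?c * r = (x * (y * r) - (y * r) * x) - y * (x * r - r * x)"
        by (simp add: algebra_simps)
      also have "\<dots> \<in> V" using xy by (intro Vdiff Vlie Vmult)
      finally show ?thesis .
    qed
    have "s * ?c * r \<in> V" for s r
    proof -
      have "s * ?c * r = ?c * (r * s) - (?c * r * s - s * (?c * r))"
        by (simp add: algebra_simps)
      also have "\<dots> \<in> V" by (intro Vdiff Vlie right)
      finally show ?thesis .
    qed
    then have "V = UNIV"
      using simple_ring_eq_UNIV_if_absorbs[OF simple V0 Vadd nz] by blast
    then show ?thesis using VD by blast
  next
    case False
    have "U \<subseteq> ring_center"
    proof
      fix a assume "a \<in> U"
      then have a: "a \<in> V" using UV by blast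
      define d where "d = (\<lambda>r. a * r - r * a)"
      have dd: "d (d r) = 0" for r
      proof -
        have "d r \<in> V" unfolding d_def by (rule Vlie[OF a])
        then have "a * d r - d r * a = 0" using False a by blast
        then show ?thesis by (simp add: d_def)
      qed
      have leibniz: "d (r * s) = d r * s + r * d s" for r s
        by (simp add: d_def algebra_simps)
      have d_add: "d (r + s) = d r + d s" for r s by (simp add: d_def algebra_simps)
      (* The Leibniz rule for the second derivative gives 2 (d r) (d s) = 0. *)
      have dd_mult: "d r * d s = 0" for r s
      proof (rule torsion)
        have "0 = d (d (r * s))" by (simp add: dd)
        also have "\<dots> = d r * d s + d r * d s" by (simp add: leibniz d_add dd)
        finally show "d r * d s + d r * d s = 0" by simp
      qed
      have "d r * s * d r = 0" for r s
      proof -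
        have "0 = d r * d (s * r)" by (simp add: dd_mult)
        also have "\<dots> = d r * d s * r + d r * s * d r"
          by (simp add: leibniz distrib_left mult.assoc)
        finally show ?thesis by (simp add: dd_mult)
      qed
      then have "d r = 0" for r using simple_ring_prime[OF simple, of "d r" "d r"] by blast
      then show "a \<in> ring_center" by (simp add: ring_center_def d_def)
    qed
    then show ?thesis ..
  qed
qed

section \<open>Powers of subsets of an algebra\<close>

context unital_algebra
begin

lemma span_mult_mem:
  assumes W: "subspace W" and AB: "\<And>a b. a \<in> A \<Longrightarrow> b \<in> B \<Longrightarrow> a * b \<in> W"
    and "x \<in> span A" "y \<in> span B"
  shows "x * y \<in> W"
proof -
  have "subspace {a. a * b \<in> W}" for b
    by (rule subspaceI)
       (auto simp: distrib_right scale_mult_left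
         intro: subspace_0[OF W] subspace_add[OF W] subspace_scale[OF W])
  then have "span A \<subseteq> {a. a * b \<in> W}" if "b \<in> B" for b
    using that AB by (intro span_minimal) auto
  then have "x * b \<in> W" if "b \<in> B" for b using that assms(3) by blast
  moreover have "subspace {b. x * b \<in> W}"
    by (rule subspaceI)
       (auto simp: distrib_left scale_mult_right
         intro: subspace_0[OF W] subspace_add[OF W] subspace_scale[OF W])
  ultimately have "span B \<subseteq> {b. x * b \<in> W}" by (intro span_minimal) auto
  then show ?thesis using assms(4) by blast
qed

lemma subspace_subspace_power [simp]: "subspace (subspace_power A n)"
  unfolding subspace_power_def by (rule subspace_span)

lemma subspace_jordan_product [simp]: "subspace (jordan_product A B)"
  unfolding jordan_product_def by (rule subspace_span)

lemma subspace_power_mult: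
  assumes "x \<in> subspace_power A m" "y \<in> subspace_power A n"
  shows "x * y \<in> subspace_power A (m + n)"
  using assms unfolding subspace_power_def
proof (rule span_mult_mem[OF subspace_span, rotated 1])
  fix a b
  assume "a \<in> {prod_list xs | xs. set xs \<subseteq> A \<and> length xs = m}"
    and "b \<in> {prod_list xs | xs. set xs \<subseteq> A \<and> length xs = n}"
  then obtain xs ys where "a = prod_list xs" "set xs \<subseteq> A" "length xs = m"
    "b = prod_list ys" "set ys \<subseteq> A" "length ys = n" by blast
  then have "a * b = prod_list (xs @ ys)" "set (xs @ ys) \<subseteq> A" "length (xs @ ys) = m + n" by auto
  then show "a * b \<in> span {prod_list xs | xs. set xs \<subseteq> A \<and> length xs = m + n}"
    by (intro span_base) blast
qed

lemma subspace_power_1I: "a \<in> A \<Longrightarrow> a \<in> subspace_power A 1"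
  unfolding subspace_power_def by (intro span_base) (auto intro!: exI[of _ "[a]"])

lemma subspace_power_2I: "a \<in> A \<Longrightarrow> b \<in> A \<Longrightarrow> a * b \<in> subspace_power A 2"
  using subspace_power_mult[OF subspace_power_1I subspace_power_1I, of a A b]
  by (simp add: numeral_2_eq_2)

lemma subspace_power_2_subset:
  assumes "subspace W" "\<And>a b. a \<in> A \<Longrightarrow> b \<in> A \<Longrightarrow> a * b \<in> W"
  shows "subspace_power A 2 \<subseteq> W"
  unfolding subspace_power_def
  by (rule span_minimal) (use assms in \<open>auto simp: length_Suc_conv numeral_2_eq_2\<close>)

lemma subspace_power_subset_power_mult:
  assumes "B \<subseteq> subspace_power A m"
  shows "subspace_power B n \<subseteq> subspace_power A (m * n)"
proof -
  have "prod_list xs \<in> subspace_power A (m * length xs)" if "set xs \<subseteq> B" for xs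
    using that
  proof (induction xs)
    case Nil
    show ?case unfolding subspace_power_def by (intro span_base) simp
  next
    case (Cons x xs)
    then have "x * prod_list xs \<in> subspace_power A (m + m * length xs)"
      using assms by (intro subspace_power_mult) auto
    then show ?case by simp
  qed
  then show ?thesis
    unfolding subspace_power_def[of B] by (intro span_minimal) auto
qed

lemma jordan_product_subset_power_2: "jordan_product A A \<subseteq> subspace_power A 2"
  unfolding jordan_product_def
  by (rule span_minimal) (auto intro: subspace_add subspace_power_2I)

lemma scale_one_mult: "scale a x = scale a 1 * x"
  by (simp add: scale_mult_left)

lemma scale_one_central: "scale a 1 \<in> ring_center"
  by (simp add: ring_center_def scale_mult_left scale_mult_right)

end

section \<open>Involutions of the first kind\<close>

locale simple_algebra_first_kind_involution = unital_algebra scale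
  for scale :: "'f::field \<Rightarrow> 'r::ring_1 \<Rightarrow> 'r" +
  fixes star :: "'r \<Rightarrow> 'r"
  assumes char_not_2: "CHAR('f) \<noteq> 2"
    and simple: "simple_ring TYPE('r)"
    and involution: "involution star"
    and first_kind: "first_kind star"
begin

abbreviation S where "S \<equiv> symmetric_elements star"
abbreviation K where "K \<equiv> skew_elements star"

lemma mem_S: "x \<in> S \<longleftrightarrow> star x = x"
  by (simp add: symmetric_elements_def)

lemma mem_K: "x \<in> K \<longleftrightarrow> star x = - x"
  by (simp add: skew_elements_def)

lemma star_add: "star (x + y) = star x + star y"
  and star_mult: "star (x * y) = star y * star x"
  and star_star [simp]: "star (star x) = x"
  using involution unfolding involution_def by blast+

lemma star_zero [simp]: "star 0 = 0"
  using star_add[of 0 0] by simp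

lemma star_minus: "star (- x) = - star x"
  using star_add[of x "- x"] by (simp add: eq_neg_iff_add_eq_0 add.commute)

lemma star_diff: "star (x - y) = star x - star y"
  using star_add[of x "- y"] by (simp add: star_minus)

lemma star_center: "z \<in> ring_center \<Longrightarrow> star z = z"
  using first_kind unfolding first_kind_def symmetric_elements_def by blast

lemma star_scale: "star (scale a x) = scale a (star x)"
proof -
  have "star (scale a x) = star x * scale a 1"
    by (subst scale_one_mult) (simp only: star_mult star_center[OF scale_one_central])
  then show ?thesis by (simp add: scale_mult_right)
qed

lemmas star_simps = star_add star_mult star_minus star_diff star_scale

lemma subspace_S: "subspace S"
  by (rule subspaceI) (simp_all add: mem_S star_simps)

definition half :: "'r \<Rightarrow> 'r" where "half x = scale (inverse 2) x"

lemma half_add_half [simp]: "half x + half x = x"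
proof -
  have "(2::'f) \<noteq> 0"
  proof
    assume "(2::'f) = 0"
    then have "of_nat 2 = (0::'f)" by simp
    then have "CHAR('f) dvd 2" by (simp only: of_nat_eq_0_iff_char_dvd)
    moreover have "CHAR('f) \<noteq> 1" by simp
    moreover have "CHAR('f) \<le> 2" using \<open>CHAR('f) dvd 2\<close> by (rule dvd_imp_le) simp
    moreover have "CHAR('f) \<noteq> 0"
    proof
      assume "CHAR('f) = 0"
      with \<open>CHAR('f) dvd 2\<close> show False by simp
    qed
    ultimately show False using char_not_2 by linarith
  qed
  then have "inverse (2::'f) + inverse 2 = 1"
    by (metis mult_2 right_inverse)
  then show ?thesis unfolding half_def by (metis scale_left_distrib scale_one)
qed

lemma half_double [simp]: "half (x + x) = x"
proof -
  have "half (x + x) = half x + half x" unfolding half_def by (rule scale_right_distrib)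
  then show ?thesis by simp
qed

lemma eq_zero_if_double_zero:
  assumes "x + x = (0::'r)"
  shows "x = 0"
proof -
  have "x = half (x + x)" by simp
  also have "\<dots> = 0" unfolding assms by (simp add: half_def)
  finally show ?thesis .
qed

lemma mem_subspace_if_double:
  assumes "subspace W" "x + x \<in> W"
  shows "x \<in> W"
proof -
  have "half (x + x) \<in> W" unfolding half_def by (rule subspace_scale[OF assms])
  then show ?thesis by simp
qed

lemma half_center: "z \<in> ring_center \<Longrightarrow> half z \<in> ring_center"
  using ring_center_mult[OF scale_one_central, of z "inverse 2"]
  by (simp add: half_def scale_one_mult[symmetric])

lemma symmetric_skew_decomposition:
  obtains s k where "s \<in> S" "k \<in> K" "r = s + k" "s + s = r + star r"
proof
  show "half (r + star r) \<in> S" by (simp add: half_def mem_S star_simps add.commute)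
  show "half (r - star r) \<in> K"
    unfolding half_def mem_K star_simps scale_minus_right[symmetric] by simp
  have "half (r + star r) + half (r - star r) = half (r + r)"
    by (simp add: half_def scale_right_distrib[symmetric])
  then show "r = half (r + star r) + half (r - star r)" by simp
qed simp

text \<open>The identities \<open>[a b, s] = a (b \<circ> s) - (a \<circ> s) b\<close> and \<open>[a b, k] = [a, k] b + a [b, k]\<close>
  keep all factors inside \<open>A\<close>; symmetric and skew elements satisfy the two closure conditions
  because \<open>\<circ>\<close> with \<open>S\<close> and the bracket with \<open>K\<close> preserve the parity under the involution.\<close>

lemma lie_ideal_square:
  assumes AS: "\<And>a s. a \<in> A \<Longrightarrow> s \<in> S \<Longrightarrow> a * s + s * a \<in> A"
    and AK: "\<And>a k. a \<in> A \<Longrightarrow> k \<in> K \<Longrightarrow> a * k - k * a \<in> A"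
  shows "lie_ideal (subspace_power A 2)"
proof -
  let ?U = "subspace_power A 2"
  have sub: "subspace ?U" by simp
  have "?U \<subseteq> {u. u * r - r * u \<in> ?U}" for r
  proof (rule subspace_power_2_subset)
    have *: "(x + y) * r - r * (x + y) = (x * r - r * x) + (y * r - r * y)"
      "scale c x * r - r * scale c x = scale c (x * r - r * x)" for x y c
      by (simp_all add: algebra_simps scale_mult_left scale_mult_right)
    show "subspace {u. u * r - r * u \<in> ?U}"
      by (rule subspaceI) (simp_all add: * subspace_0 subspace_add subspace_scale)
  next
    fix a b assume ab: "a \<in> A" "b \<in> A"
    obtain s k where sk: "s \<in> S" "k \<in> K" "r = s + k"
      using symmetric_skew_decomposition[of r] by blast
    have "a * b * r - r * (a * b) = (a * (b * s + s * b) - (a * s + s * a) * b)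
        + ((a * k - k * a) * b + a * (b * k - k * b))"
      by (simp add: sk(3) algebra_simps)
    also have "\<dots> \<in> ?U"
      using ab AS[OF ab(1) sk(1)] AS[OF ab(2) sk(1)] AK[OF ab(1) sk(2)] AK[OF ab(2) sk(2)]
      by (intro subspace_add[OF sub] subspace_diff[OF sub] subspace_power_2I)
    finally show "a * b \<in> {u. u * r - r * u \<in> ?U}" by simp
  qed
  then show ?thesis
    unfolding lie_ideal_def by (auto intro: subspace_0 subspace_diff)
qed

lemma power_2_contains_commutators:
  assumes "\<And>a s. a \<in> A \<Longrightarrow> s \<in> S \<Longrightarrow> a * s + s * a \<in> A"
    and "\<And>a k. a \<in> A \<Longrightarrow> k \<in> K \<Longrightarrow> a * k - k * a \<in> A"
    and "a \<in> A" "b \<in> A" "a * b \<notin> ring_center"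
  shows "x * y - y * x \<in> subspace_power A 2"
proof -
  have "lie_ideal (subspace_power A 2)" using assms(1,2) by (rule lie_ideal_square)
  then have "subspace_power A 2 \<subseteq> ring_center \<or> (\<forall>x y. x * y - y * x \<in> subspace_power A 2)"
    by (intro lie_ideal_central_or_contains_commutators[OF simple]) (erule eq_zero_if_double_zero)
  then show ?thesis using subspace_power_2I[OF assms(3,4)] assms(5) by blast
qed

section \<open>The symmetric elements as Jordan products of skew elements\<close>

text \<open>Suppose that all products \<open>k l\<close> are central. Some \<open>k\<close> has \<open>k\<^sup>2 \<noteq> 0\<close>, as otherwise
  \<open>k R k = 0\<close> for every \<open>k\<close>. Then \<open>k\<^sup>2\<close> is central and nonzero, hence has a central inverse \<open>i\<close>, and
  \<open>l = i (k l) k\<close>, so \<open>K = Z k\<close>. For symmetric \<open>s\<close>, the element \<open>s \<circ> k\<close> is skew,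
  hence in \<open>Z k\<close>, and a central shift of \<open>s\<close> anticommutes with \<open>k\<close>; let \<open>S0\<close> be the set of
  symmetric elements that do. For \<open>s, t \<in> S0\<close> the element \<open>t k\<close> is symmetric too and
  \<open>[s, t k] = (s \<circ> t) k\<close>, so \<open>s \<circ> t\<close> is central and \<open>s t \<in> Z + Z k\<close>. Noncommutativity of
  \<open>S\<close> yields \<open>s \<in> S0\<close> with \<open>s\<^sup>2 \<noteq> 0\<close>, and dividing by it gives \<open>S0 = Z s + Z s k\<close>.\<close>

lemma skew_product_not_central:
  assumes proper: "S \<noteq> UNIV" and noncomm: "\<not> commutative_set S"
    and dim: "center_dim_greater TYPE('r) 4"
  shows "\<exists>k\<in>K. \<exists>l\<in>K. k * l \<notin> ring_center"
proof (rule ccontr)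
  assume "\<not> ?thesis"
  then have KK: "k * l \<in> ring_center" if "k \<in> K" "l \<in> K" for k l using that by blast
  have comm: "x * z = z * x" if "z \<in> ring_center" for x z
    using that by (rule ring_center_commute)
  have cancel: "z = 0 \<or> x = 0" if "z \<in> ring_center" "z * x = 0" for z x :: 'r
    using simple_ring_center_no_zero_divisors[OF simple that] .
  have "\<exists>k\<in>K. k * k \<noteq> 0"
  proof (rule ccontr)
    assume "\<not> ?thesis"
    then have sq: "k * k = 0" if "k \<in> K" for k using that by blast
    have prod0: "k * l = 0" if kl: "k \<in> K" "l \<in> K" for k l
    proof -
      have "star (k * l) = l * k" using kl by (simp add: mem_K star_mult)
      then have "k * l = l * k" using star_center[OF KK[OF kl]] by simp
      then have "(k * l) * (k * l) = k * k * (l * l)" by (metis mult.assoc)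
      then show ?thesis using cancel[OF KK[OF kl]] sq kl by auto
    qed
    obtain r where "star r \<noteq> r" using proper mem_S by blast
    define k where "k = r - star r"
    have k: "k \<in> K" "k \<noteq> 0" using \<open>star r \<noteq> r\<close> by (auto simp: k_def mem_K star_simps)
    have "k * x * k = 0" for x
    proof -
      obtain s l where sl: "s \<in> S" "l \<in> K" "x = s + l"
        using symmetric_skew_decomposition[of x] by blast
      have "k * s + s * k \<in> K" using k sl by (simp add: mem_K mem_S star_simps)
      then have "k * (k * s + s * k) = 0" using prod0 k by blast
      then have "k * s * k = 0" using sq[OF k(1)] by (simp add: distrib_left mult.assoc[symmetric])
      moreover have "k * l = 0" using prod0 k sl by blast
      ultimately show ?thesis by (simp add: sl(3) algebra_simps)
    qed
    then show False using simple_ring_prime[OF simple, of k k] k(2) by blast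
  qed
  then obtain k where k: "k \<in> K" "k * k \<noteq> 0" by blast
  obtain i where i: "i \<in> ring_center" "i * (k * k) = 1"
    using simple_ring_center_inverse[OF simple KK[OF k(1) k(1)] k(2)] .
  have K_eq: "\<exists>w\<in>ring_center. l = w * k" if "l \<in> K" for l
  proof
    show "i * (k * l) \<in> ring_center" using i(1) KK[OF k(1) that] by (rule ring_center_mult)
    have "i * (k * l) * k = i * (k * k) * l"
      using comm[OF KK[OF k(1) that], of k] by (simp add: mult.assoc)
    then show "l = i * (k * l) * k" using i by simp
  qed
  (* k is invertible, with inverse i k *)
  have cancel_k: "x = y" if "x * k = y * k" for x y
  proof -
    have "x * (k * k) * i = y * (k * k) * i" using that by (simp add: mult.assoc[symmetric])
    moreover have "k * k * i = 1" using i comm[OF i(1), of "k * k"] by simp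
    ultimately show ?thesis by (simp add: mult.assoc)
  qed
  define S0 where "S0 = {s \<in> S. s * k + k * s = 0}"
  have shift: "\<exists>z\<in>ring_center. s - z \<in> S0" if s: "s \<in> S" for s
  proof -
    have "s * k + k * s \<in> K" using s k by (simp add: mem_K mem_S star_simps)
    then obtain w where w: "w \<in> ring_center" "s * k + k * s = w * k" using K_eq by blast
    let ?z = "half w"
    have z: "?z \<in> ring_center" using w half_center by blast
    have "(s - ?z) * k + k * (s - ?z) = (s * k + k * s) - (?z + ?z) * k"
      using comm[OF z, of k] by (simp add: algebra_simps del: half_add_half)
    then have "(s - ?z) * k + k * (s - ?z) = 0" using w by simp
    moreover have "s - ?z \<in> S" using s star_center[OF z] by (simp add: mem_S star_simps)
    ultimately show ?thesis using z by (auto simp: S0_def)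
  qed
  have jordan: "s * t + t * s \<in> ring_center" if s: "s \<in> S0" and t: "t \<in> S0" for s t
  proof -
    have anti: "k * s = - (s * k)" "k * t = - (t * k)" and sym: "star s = s" "star t = t" "star k = - k"
      using s t k by (auto simp: S0_def mem_S mem_K eq_neg_iff_add_eq_0 add.commute)
    have "s * (t * k) - (t * k) * s \<in> K"
      by (simp add: mem_K star_simps sym anti mult.assoc)
    moreover have "s * (t * k) - (t * k) * s = (s * t + t * s) * k"
      by (simp add: anti mult.assoc algebra_simps)
    ultimately show ?thesis using K_eq cancel_k by metis
  qed
  have bracket: "\<exists>w\<in>ring_center. s * t - t * s = w * k" if "s \<in> S0" "t \<in> S0" for s t
    using that by (intro K_eq) (simp add: S0_def mem_K mem_S star_simps)
  have prod: "\<exists>z\<in>ring_center. \<exists>w\<in>ring_center. s * t = z + w * k" if st: "s \<in> S0" "t \<in> S0" for s t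
  proof -
    obtain w where w: "w \<in> ring_center" "s * t - t * s = w * k" using bracket st by blast
    have "s * t = half (s * t + s * t)" by simp
    also have "\<dots> = half ((s * t + t * s) + w * k)" using w(2) by (simp add: algebra_simps)
    also have "\<dots> = half (s * t + t * s) + half w * k"
      by (simp add: half_def scale_right_distrib scale_mult_left)
    finally show ?thesis using w(1) half_center jordan[OF st] by blast
  qed
  (* If all squares vanish, polarization makes elements of S0 anticommute, and a nonzero bracket
     [s, t] = 2 s t = w k is annihilated by s, whence w s = 0. *)
  have "\<exists>s\<in>S0. s * s \<noteq> 0"
  proof (rule ccontr)
    assume "\<not> ?thesis"
    then have sq: "s * s = 0" if "s \<in> S0" for s using that by blast
    obtain s t where st: "s \<in> S" "t \<in> S" "s * t \<noteq> t * s"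
      using noncomm unfolding commutative_set_def by blast
    obtain z where z: "z \<in> ring_center" "s - z \<in> S0" using shift st by blast
    obtain z' where z': "z' \<in> ring_center" "t - z' \<in> S0" using shift st by blast
    let ?s = "s - z" and ?t = "t - z'"
    have "?s * ?t - ?t * ?s = s * t - t * s"
      using comm[OF z(1), of t] comm[OF z(1), of z'] comm[OF z'(1), of s] by (simp add: algebra_simps)
    then have ne: "?s * ?t - ?t * ?s \<noteq> 0" using st(3) by simp
    have "?s + ?t \<in> S0" using z z' subspace_add[OF subspace_S]
      by (simp add: S0_def) (simp add: algebra_simps)
    then have "(?s + ?t) * (?s + ?t) = 0" using sq by blast
    moreover have "(?s + ?t) * (?s + ?t) = ?s * ?s + ?t * ?t + (?s * ?t + ?t * ?s)"
      by (simp only: distrib_left distrib_right ac_simps)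
    ultimately have anti: "?t * ?s = - (?s * ?t)"
      using sq[OF z(2)] sq[OF z'(2)] by (simp add: eq_neg_iff_add_eq_0 add.commute)
    obtain w where w: "w \<in> ring_center" "?s * ?t - ?t * ?s = w * k" using bracket z z' by blast
    have "?s * (w * k) = 0"
      using w(2)[symmetric] anti sq[OF z(2)] by (simp only: diff_minus_eq_add distrib_left mult.assoc[symmetric]) simp
    moreover have "?s * (w * k) = w * ?s * k" using comm[OF w(1), of ?s] by (simp only: mult.assoc[symmetric])
    ultimately have "w * ?s = 0" using cancel_k[of "w * ?s" 0] by simp
    then consider "w = 0" | "?s = 0" using cancel[OF w(1)] by blast
    then show False using ne w(2) by cases simp_all
  qed
  then obtain s where s: "s \<in> S0" "s * s \<noteq> 0" by blast
  have "s * s \<in> ring_center"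
    using half_center[OF jordan[OF s(1) s(1)]] by simp
  then obtain j where j: "j \<in> ring_center" "j * (s * s) = 1"
    using simple_ring_center_inverse[OF simple] s(2) by metis
  have "\<not> center_dim_greater TYPE('r) 4"
  proof (rule not_center_dim_greater_if_spanned[OF simple, where e = "(!) [1, k, s, s * k]"])
    fix x
    obtain u l where ul: "u \<in> S" "l \<in> K" "x = u + l"
      using symmetric_skew_decomposition[of x] by blast
    obtain v where v: "v \<in> ring_center" "l = v * k" using K_eq ul(2) by blast
    obtain z where z: "z \<in> ring_center" "u - z \<in> S0" using shift ul(1) by blast
    obtain p q where pq: "p \<in> ring_center" "q \<in> ring_center" "s * (u - z) = p + q * k"
      using prod s(1) z(2) by blast
    have "u - z = j * s * (s * (u - z))" using j(2) by (simp add: mult.assoc[symmetric])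
    also have "\<dots> = j * p * s + j * q * (s * k)"
      using comm[OF pq(1), of s] comm[OF pq(2), of s]
      by (simp add: pq(3) distrib_left mult.assoc) (simp add: mult.assoc[symmetric])
    finally have "x = z * 1 + v * k + j * p * s + j * q * (s * k)"
      using ul(3) v(2) by (simp add: algebra_simps)
    then have "x = (\<Sum>i<4. [z, v, j * p, j * q] ! i * [1, k, s, s * k] ! i)"
      by (simp add: eval_nat_numeral lessThan_Suc algebra_simps)
    moreover have "\<forall>i<4. [z, v, j * p, j * q] ! i \<in> ring_center"
      using z v j pq by (auto simp: eval_nat_numeral less_Suc_eq intro: ring_center_mult)
    ultimately show "\<exists>c. (\<forall>i<4. c i \<in> ring_center) \<and> x = (\<Sum>i<4. c i * [1, k, s, s * k] ! i)"
      by blast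
  qed
  then show False using dim by blast
qed

text \<open>Since \<open>K\<^sup>2\<close> contains all commutators, symmetrizing gives \<open>[K, S] \<subseteq> I\<close> for
  \<open>I = K \<circ> K\<close>. The identity
  \<open>(k \<circ> l) \<circ> s = k \<circ> (l \<circ> s) + [l, [k, s]]\<close> then gives \<open>I \<circ> S \<subseteq> I\<close>. These two
  inclusions make \<open>I + K\<close> a two-sided ideal. It is represented as \<open>{x. x + star x \<in> I}\<close>,
  which is visibly stable under the involution, so absorption on the right suffices.\<close>

lemma jordan_product_skew_eq_symmetric:
  assumes proper: "S \<noteq> UNIV"
    and kl: "k0 \<in> K" "l0 \<in> K" "k0 * l0 \<notin> ring_center"
  shows "jordan_product K K = S"
proof
  let ?I = "jordan_product K K"
  have I: "subspace ?I" by simp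
  have gen: "k * l + l * k \<in> ?I" if "k \<in> K" "l \<in> K" for k l
    unfolding jordan_product_def using that by (intro span_base) blast
  show "?I \<subseteq> S"
    unfolding jordan_product_def
    by (rule span_minimal[OF _ subspace_S]) (auto simp: mem_S mem_K star_simps add.commute)
  have trace_add: "x + y + star (x + y) \<in> ?I" if "x + star x \<in> ?I" "y + star y \<in> ?I" for x y
  proof -
    have "x + y + star (x + y) = (x + star x) + (y + star y)" by (simp add: star_add)
    then show ?thesis using subspace_add[OF I that] by (simp only:)
  qed
  have "subspace_power K 2 \<subseteq> {x. x + star x \<in> ?I}"
  proof (rule subspace_power_2_subset)
    show "subspace {x. x + star x \<in> ?I}"
      by (rule subspaceI)
         (simp_all add: trace_add star_scale subspace_0 subspace_scale scale_right_distrib[symmetric])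
    show "a * b \<in> {x. x + star x \<in> ?I}" if "a \<in> K" "b \<in> K" for a b
      using gen[OF that] that by (simp add: mem_K star_simps)
  qed
  then have trace: "x + star x \<in> ?I" if "x \<in> subspace_power K 2" for x using that by blast
  have bracket: "k * s - s * k \<in> ?I" if ks: "k \<in> K" "s \<in> S" for k s
  proof -
    have "k * s - s * k \<in> subspace_power K 2"
      by (rule power_2_contains_commutators[OF _ _ kl]) (auto simp: mem_K mem_S star_simps)
    then have "(k * s - s * k) + star (k * s - s * k) \<in> ?I" by (rule trace)
    moreover have "star (k * s - s * k) = k * s - s * k"
      using ks by (simp add: mem_K mem_S star_simps)
    ultimately have "(k * s - s * k) + (k * s - s * k) \<in> ?I" by (simp only:)
    then show ?thesis by (rule mem_subspace_if_double[OF I])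
  qed
  have jordan: "i * s + s * i \<in> ?I" if "i \<in> ?I" and s: "s \<in> S" for i s
  proof -
    have "?I \<subseteq> {i. i * s + s * i \<in> ?I}"
      unfolding jordan_product_def[of K K]
    proof (rule span_minimal)
      have *: "(x + y) * s + s * (x + y) = (x * s + s * x) + (y * s + s * y)"
        "scale c x * s + s * scale c x = scale c (x * s + s * x)" for x y c
        by (simp_all add: algebra_simps scale_mult_left scale_mult_right)
      show "subspace {i. i * s + s * i \<in> span {a * b + b * a | a b. a \<in> K \<and> b \<in> K}}"
        by (rule subspaceI) (simp_all only: mem_Collect_eq *, simp_all add: span_zero span_add span_scale)
      show "{a * b + b * a | a b. a \<in> K \<and> b \<in> K}
          \<subseteq> {i. i * s + s * i \<in> span {a * b + b * a | a b. a \<in> K \<and> b \<in> K}}"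
      proof
        fix i assume "i \<in> {a * b + b * a | a b. a \<in> K \<and> b \<in> K}"
        then obtain k l where kl: "k \<in> K" "l \<in> K" and i: "i = k * l + l * k" by blast
        have "i * s + s * i = (k * (l * s + s * l) + (l * s + s * l) * k)
            + (l * (k * s - s * k) - (k * s - s * k) * l)"
          by (simp add: i algebra_simps)
        also have "\<dots> \<in> ?I"
        proof (rule subspace_add[OF I])
          have "l * s + s * l \<in> K" using kl s by (simp add: mem_K mem_S star_simps)
          then show "k * (l * s + s * l) + (l * s + s * l) * k \<in> ?I" by (rule gen[OF kl(1)])
          have "k * s - s * k \<in> S" using kl s by (simp add: mem_K mem_S star_simps)
          then show "l * (k * s - s * k) - (k * s - s * k) * l \<in> ?I" by (rule bracket[OF kl(2)])
        qed
        finally show "i \<in> {i. i * s + s * i \<in> span {a * b + b * a | a b. a \<in> K \<and> b \<in> K}}"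
          by (simp add: jordan_product_def)
      qed
    qed
    then show ?thesis using that by blast
  qed
  let ?M = "{x. x + star x \<in> ?I}"
  have star_M: "star x \<in> ?M" if "x \<in> ?M" for x using that by (simp add: add.commute)
  have right: "x * r \<in> ?M" if x: "x \<in> ?M" for x r
  proof -
    obtain i k where ik: "i \<in> S" "k \<in> K" "x = i + k" "i + i = x + star x"
      using symmetric_skew_decomposition[of x] by blast
    have i: "i \<in> ?I" by (rule mem_subspace_if_double[OF I]) (use x ik(4) in simp)
    obtain u l where ul: "u \<in> S" "l \<in> K" "r = u + l"
      using symmetric_skew_decomposition[of r] by blast
    have "star (x * r) = (u - l) * (i - k)"
      using ik ul by (simp add: mem_S mem_K star_simps)
    then have "x * r + star (x * r) = (i * u + u * i) - (l * i - i * l) + (k * u - u * k) + (k * l + l * k)"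
      by (simp add: ik(3) ul(3) algebra_simps)
    also have "\<dots> \<in> ?I"
      by (rule subspace_add[OF I subspace_add[OF I subspace_diff[OF I]]]
          jordan[OF i ul(1)] bracket[OF ul(2) ik(1)] bracket[OF ik(2) ul(1)] gen[OF ik(2) ul(2)])+
    finally show ?thesis by simp
  qed
  have left: "r * x \<in> ?M" if "x \<in> ?M" for x r
    using star_M[OF right[OF star_M[OF that], of "star r"]] by (simp add: star_mult)
  obtain r where "star r \<noteq> r" using proper mem_S by blast
  have "?M = UNIV"
  proof (rule simple_ring_eq_UNIV_if_absorbs[OF simple])
    show "0 \<in> ?M" using subspace_0[OF I] by simp
    show "x + y \<in> ?M" if "x \<in> ?M" "y \<in> ?M" for x y
      using that trace_add by simp
    show "r - star r \<noteq> 0" using \<open>star r \<noteq> r\<close> by simp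
    have "r - star r \<in> ?M" using subspace_0[OF I] by (simp add: star_diff)
    then show "a * (r - star r) * b \<in> ?M" for a b using left right by blast
  qed
  then have double: "s + star s \<in> ?I" for s by blast
  show "S \<subseteq> ?I"
  proof
    fix s assume "s \<in> S"
    then have "s + s \<in> ?I" using double[of s] by (simp add: mem_S)
    then show "s \<in> ?I" by (rule mem_subspace_if_double[OF I])
  qed
qed

section \<open>Powers of the symmetric elements\<close>

lemma symmetric_square_contains_commutators:
  assumes "\<not> commutative_set S"
  shows "x * y - y * x \<in> subspace_power S 2"
proof -
  obtain s t where st: "s \<in> S" "t \<in> S" "s * t \<noteq> t * s"
    using assms unfolding commutative_set_def by blast
  then have "s * 1 \<notin> ring_center" by (auto simp: ring_center_def)
  moreover have "1 \<in> S" by (simp add: mem_S star_center)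
  ultimately show ?thesis
    using st by (intro power_2_contains_commutators[of S s 1]) (auto simp: mem_K mem_S star_simps add.commute)
qed

lemma symmetric_subset_square: "s \<in> S \<Longrightarrow> s \<in> subspace_power S 2"
  using subspace_power_2I[of s S 1] by (simp add: mem_S star_center)

text \<open>Up to a commutator, \<open>r c s\<close> is \<open>c s r\<close>.\<close>

lemma eq_UNIV_if_right_ideal_and_commutators:
  assumes W: "subspace W" and comm: "\<And>x y. x * y - y * x \<in> W"
    and "c \<noteq> 0" and right: "\<And>r. c * r \<in> W"
  shows "W = UNIV"
proof (rule simple_ring_eq_UNIV_if_absorbs[OF simple])
  fix r s
  have "r * c * s = (r * (c * s) - (c * s) * r) + c * (s * r)" by (simp add: algebra_simps)
  also have "\<dots> \<in> W" using comm right by (intro subspace_add[OF W])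
  finally show "r * c * s \<in> W" .
qed (use assms subspace_0 subspace_add in auto)

lemma symmetric_cube_eq_UNIV:
  assumes noncomm: "\<not> commutative_set S"
  shows "subspace_power S 3 = UNIV"
proof -
  let ?W = "subspace_power S 3"
  have sub: "subspace ?W" by simp
  have one: "1 \<in> S" by (simp add: mem_S star_center)
  have mult: "s * u \<in> ?W" if "s \<in> S" "u \<in> subspace_power S 2" for s u
    using subspace_power_mult[OF subspace_power_1I[OF that(1)] that(2)] by (simp add: numeral_3_eq_3)
  have comm: "x * y - y * x \<in> subspace_power S 2" for x y
    by (rule symmetric_square_contains_commutators[OF noncomm])
  have comm3: "x * y - y * x \<in> ?W" for x y using mult[OF one comm] by simp
  obtain s t where st: "s \<in> S" "t \<in> S" "s * t \<noteq> t * s"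
    using noncomm unfolding commutative_set_def by blast
  have "(s * t - t * s) * r \<in> ?W" for r
  proof -
    have "(s * t - t * s) * r = (s * (t * r) - (t * r) * s) - t * (s * r - r * s)"
      by (simp add: algebra_simps)
    also have "\<dots> \<in> ?W" by (rule subspace_diff[OF sub comm3 mult[OF st(2) comm]])
    finally show ?thesis .
  qed
  then show ?thesis
    using eq_UNIV_if_right_ideal_and_commutators[OF sub comm3, of "s * t - t * s"] st(3) by simp
qed

lemma star_symmetric_square:
  assumes "u \<in> subspace_power S 2"
  shows "star u \<in> subspace_power S 2"
proof -
  have "subspace_power S 2 \<subseteq> {u. star u \<in> subspace_power S 2}"
  proof (rule subspace_power_2_subset)
    show "subspace {u. star u \<in> subspace_power S 2}"
      by (rule subspaceI) (simp_all add: star_simps subspace_0 subspace_add subspace_scale)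
  qed (auto simp: mem_S star_mult intro: subspace_power_2I)
  then show ?thesis using assms by blast
qed

text \<open>Put \<open>c = [x, y]\<close>, which is skew. Applying the involution to \<open>x s y\<close> and rotating cyclically
  shows that \<open>x y s\<close> and \<open>y x s\<close> lie in \<open>S\<^sup>2\<close>, hence \<open>c S \<subseteq> S\<^sup>2\<close>. For skew \<open>k\<close>,
  \<open>2 c k = c \<circ> k + [c, k]\<close> is the sum of a symmetric element and a commutator.\<close>

lemma symmetric_square_eq_UNIV_symmetric:
  assumes noncomm: "\<not> commutative_set S"
    and x: "x \<in> S" and y: "y \<in> S" and ne: "x * y - y * x \<noteq> 0"
    and xsy: "\<And>s. s \<in> S \<Longrightarrow> x * s * y \<in> subspace_power S 2"
  shows "subspace_power S 2 = UNIV"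
proof -
  let ?U = "subspace_power S 2" and ?c = "x * y - y * x"
  have U: "subspace ?U" by simp
  have comm: "a * b - b * a \<in> ?U" for a b
    by (rule symmetric_square_contains_commutators[OF noncomm])
  have star_U: "star u \<in> ?U" if "u \<in> ?U" for u using that by (rule star_symmetric_square)
  have "?c * r \<in> ?U" for r
  proof -
    obtain s k where sk: "s \<in> S" "k \<in> K" "r = s + k"
      using symmetric_skew_decomposition[of r] by blast
    have "star (x * s * y) = y * s * x" using x y sk by (simp add: mem_S star_mult mult.assoc)
    then have ysx: "y * s * x \<in> ?U" using star_U[OF xsy[OF sk(1)]] by simp
    have "?c * s = (y * s * x - (y * s * x - x * (y * s))) - (x * s * y - (x * s * y - y * (x * s)))"
      by (simp add: algebra_simps)
    also have "\<dots> \<in> ?U"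
      by (rule subspace_diff[OF U subspace_diff[OF U ysx comm]
            subspace_diff[OF U xsy[OF sk(1)] comm]])
    finally have cs: "?c * s \<in> ?U" .
    have "?c * k + k * ?c \<in> S" using x y sk by (simp add: mem_S mem_K star_simps algebra_simps)
    then have "(?c * k + k * ?c) + (?c * k - k * ?c) \<in> ?U"
      by (rule subspace_add[OF U symmetric_subset_square comm])
    then have "?c * k + ?c * k \<in> ?U" by simp
    then have "?c * k \<in> ?U" by (rule mem_subspace_if_double[OF U])
    then show ?thesis using cs subspace_add[OF U] by (simp only: sk(3) distrib_left)
  qed
  then show ?thesis using eq_UNIV_if_right_ideal_and_commutators[OF U comm ne] by blast
qed

text \<open>Here \<open>c = x \<circ> y\<close> is symmetric, so \<open>c S \<subseteq> S\<^sup>2\<close> is immediate, and \<open>c K \<subseteq> S\<^sup>2\<close>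
  follows by the same cyclic rotation.\<close>

lemma symmetric_square_eq_UNIV_skew:
  assumes noncomm: "\<not> commutative_set S"
    and x: "x \<in> S" and y: "y \<in> S" and ne: "x * y + y * x \<noteq> 0"
    and xky: "\<And>k. k \<in> K \<Longrightarrow> x * k * y \<in> subspace_power S 2"
  shows "subspace_power S 2 = UNIV"
proof -
  let ?U = "subspace_power S 2" and ?c = "x * y + y * x"
  have U: "subspace ?U" by simp
  have comm: "a * b - b * a \<in> ?U" for a b
    by (rule symmetric_square_contains_commutators[OF noncomm])
  have "?c * r \<in> ?U" for r
  proof -
    obtain s k where sk: "s \<in> S" "k \<in> K" "r = s + k"
      using symmetric_skew_decomposition[of r] by blast
    have "star (x * k * y) = - (y * k * x)" using x y sk by (simp add: mem_S mem_K star_mult mult.assoc)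
    then have "- (y * k * x) \<in> ?U" using star_symmetric_square[OF xky[OF sk(2)]] by simp
    then have ykx: "y * k * x \<in> ?U" using subspace_neg[OF U] by force
    have "?c * k = (y * k * x - (y * k * x - x * (y * k))) + (x * k * y - (x * k * y - y * (x * k)))"
      by (simp add: algebra_simps)
    also have "\<dots> \<in> ?U"
      by (rule subspace_add[OF U subspace_diff[OF U ykx comm]
            subspace_diff[OF U xky[OF sk(2)] comm]])
    finally have ck: "?c * k \<in> ?U" .
    have "?c * s \<in> ?U" using x y sk by (intro subspace_power_2I) (simp_all add: mem_S star_simps add.commute)
    then show ?thesis using ck subspace_add[OF U] by (simp only: sk(3) distrib_left)
  qed
  then show ?thesis using eq_UNIV_if_right_ideal_and_commutators[OF U comm ne] by blast
qed

end

theorem theorem3p2: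
  fixes scale :: "'f::field \<Rightarrow> 'r::ring_1 \<Rightarrow> 'r"
    and star :: "'r \<Rightarrow> 'r"
    and S K :: "'r set"
  defines "S \<equiv> symmetric_elements star"
    and "K \<equiv> skew_elements star"
  assumes char: "CHAR('f) \<noteq> 2"
    and alg: "unital_algebra scale"
    and simple: "simple_ring TYPE('r)"
    and dim: "center_dim_greater TYPE('r) 4"
    and inv: "involution star"
    and first: "first_kind star"
    and proper: "S \<subset> UNIV"
    and noncomm: "\<not> commutative_set S"
  shows "(unital_algebra.subspace_power scale K 6 = UNIV \<and>
          unital_algebra.subspace_power scale (unital_algebra.jordan_product scale K K) 3 = UNIV) \<and>
         ((\<exists>x\<in>S. \<exists>y\<in>S. x * y - y * x \<noteq> 0 \<and>
             (\<forall>s\<in>S. x * s * y \<in> unital_algebra.subspace_power scale S 2)) \<longrightarrow>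
          unital_algebra.subspace_power scale K 4 = UNIV \<and>
          unital_algebra.subspace_power scale (unital_algebra.jordan_product scale K K) 2 = UNIV) \<and>
         ((\<exists>x\<in>S. \<exists>y\<in>S. x * y + y * x \<noteq> 0 \<and>
             (\<forall>k\<in>K. x * k * y \<in> unital_algebra.subspace_power scale S 2)) \<longrightarrow>
          unital_algebra.subspace_power scale K 4 = UNIV \<and>
          unital_algebra.subspace_power scale (unital_algebra.jordan_product scale K K) 2 = UNIV)"
proof -
  interpret simple_algebra_first_kind_involution scale star
    using alg char simple inv first
    by (simp add: simple_algebra_first_kind_involution_def simple_algebra_first_kind_involution_axioms_def)
  have S_proper: "symmetric_elements star \<noteq> UNIV" using proper S_def by blast
  have noncomm': "\<not> commutative_set (symmetric_elements star)" using noncomm S_def by simp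
  obtain k l where "k \<in> skew_elements star" "l \<in> skew_elements star" "k * l \<notin> ring_center"
    using skew_product_not_central[OF S_proper noncomm' dim] by blast
  then have KK: "jordan_product K K = S"
    using jordan_product_skew_eq_symmetric[OF S_proper] unfolding S_def K_def by blast
  have power: "subspace_power S n \<subseteq> subspace_power K (2 * n)" for n
    using subspace_power_subset_power_mult[OF jordan_product_subset_power_2] KK by metis
  have cube: "subspace_power S 3 = UNIV"
    using symmetric_cube_eq_UNIV[OF noncomm'] by (simp add: S_def)
  have part1: "subspace_power K 6 = UNIV" using power[of 3] cube by (simp add: top_unique)
  have part2: "subspace_power K 4 = UNIV" if "subspace_power S 2 = UNIV" using power[of 2] that by (simp add: top_unique)
  have sym: "subspace_power S 2 = UNIV"
    if "\<exists>x\<in>S. \<exists>y\<in>S. x * y - y * x \<noteq> 0 \<and> (\<forall>s\<in>S. x * s * y \<in> subspace_power S 2)"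
    using that symmetric_square_eq_UNIV_symmetric[OF noncomm'] unfolding S_def by blast
  have skew: "subspace_power S 2 = UNIV"
    if "\<exists>x\<in>S. \<exists>y\<in>S. x * y + y * x \<noteq> 0 \<and> (\<forall>k\<in>K. x * k * y \<in> subspace_power S 2)"
    using that symmetric_square_eq_UNIV_skew[OF noncomm'] unfolding S_def K_def by blast
  show ?thesis using KK cube part1 part2 sym skew by simp
qed

end
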